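(* Let $A>n^2$, $f\in L^1_{\mathrm{loc}}(\mathbb{R}^d;\mathbb{R}^n)$ and $Q\subset\mathbb{R}^d$ a cube. Let $\mathcal I_{Q,f}$ be the collection of maximal dyadic subcubes $I$ of $Q$ with $\langle f\rangle_I\not\subset A\langle f\rangle_Q$. Then for every $I\in\mathcal I_{Q,f}$, $\langle f\rangle_I\subset2^dA\langle f\rangle_Q$, and \[ \sum_{I\in\mathcal I_{Q,f}}|I|<\frac{n^2}{A}|Q|. \]
   Context: For a cube $Q$, $\Phi(Q)$ is the set of real functions $\varphi$ on $\mathbb{R}^d$ with $\|\varphi\|_\infty\le1$ and $\operatorname{supp}\varphi\subset Q$, and for $f\in L^1_{\mathrm{loc}}(\mathbb{R}^d;\mathbb{R}^n)$, $\langle f\rangle_Q:=\{\frac1{|Q|}\int f\varphi\,dx:\varphi\in\Phi(Q)\}\subset\mathbb{R}^n$ (a closed convex symmetric set). $tK$ denotes dilation of a set $K$ about the origin by $t$. Dyadic subcubes of $Q$ are the cubes obtained from $Q$ by repeated bisection of its sides. *)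

theory Defs
  imports "HOL-Analysis.Analysis"
begin

text \<open>Closed cube with lower corner a and side length s.\<close>
definition cube :: "'a::euclidean_space \<Rightarrow> real \<Rightarrow> 'a set" where
  "cube a s = cbox a (a + s *\<^sub>R One)"

definition is_cube :: "'a::euclidean_space set \<Rightarrow> bool" where
  "is_cube Q \<longleftrightarrow> (\<exists>a s. s > 0 \<and> Q = cube a s)"

text \<open>Dyadic subcubes of Q: obtained by k-fold bisection of the sides (k = 0 gives Q).\<close>
definition dyadic_subcube :: "'a::euclidean_space set \<Rightarrow> 'a set \<Rightarrow> bool" where
  "dyadic_subcube I Q \<longleftrightarrow> (\<exists>a s (k::nat) (j::'a \<Rightarrow> nat). s > 0 \<and> Q = cube a s \<and>
      (\<forall>i\<in>Basis. j i < 2 ^ k) \<and>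
      I = cube (a + (\<Sum>i\<in>Basis. (s / 2 ^ k * real (j i)) *\<^sub>R i)) (s / 2 ^ k))"

text \<open>f in L^1_loc: integrable on every compact set.\<close>
definition L1_loc :: "('a::euclidean_space \<Rightarrow> 'b::euclidean_space) \<Rightarrow> bool" where
  "L1_loc f \<longleftrightarrow> (\<forall>K. compact K \<longrightarrow> set_integrable lebesgue K f)"

text \<open>The convex-body average of f over Q.\<close>
definition cavg :: "('a::euclidean_space \<Rightarrow> 'b::euclidean_space) \<Rightarrow> 'a set \<Rightarrow> 'b set" where
  "cavg f Q = {(1 / measure lebesgue Q) *\<^sub>R (LINT x|lebesgue. \<phi> x *\<^sub>R f x) | \<phi>.
      \<phi> \<in> borel_measurable lebesgue \<and> (\<forall>x. \<bar>\<phi> x\<bar> \<le> 1) \<and> (\<forall>x. x \<notin> Q \<longrightarrow> \<phi> x = 0)}"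

end

theory Submission
  imports Defs "Jordan_Normal_Form.Determinant"
begin

text \<open>Let \<open>K = \<langle>f\<rangle>\<^sub>Q\<close> and \<open>n = DIM('b)\<close>. Choosing \<open>v\<^sub>1, \<dots>, v\<^sub>m \<in> K\<close>, \<open>m \<le> n\<close>, that nearly
  maximise a determinant gives linear functionals \<open>l\<^sub>k\<close> with \<open>y = \<Sum>\<^sub>k l\<^sub>k(y) v\<^sub>k\<close> on the span
  of \<open>K\<close> and \<open>|l\<^sub>k| \<le> 2\<close> on \<open>K\<close> (\<open>\<le> 1\<close> if \<open>n = 1\<close>). Since \<open>K\<close> is closed under absolute convex
  combinations, a point \<open>y\<close> of the span with \<open>\<Sum>\<^sub>k |l\<^sub>k(y)| \<le> A\<close> lies in \<open>A K\<close>. So on every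
  cube \<open>I\<close> with \<open>\<langle>f\<rangle>\<^sub>I \<not>\<subseteq> A K\<close> the function \<open>h = \<Sum>\<^sub>k |l\<^sub>k \<circ> f|\<close> has average above \<open>A\<close>,
  whereas its average over \<open>Q\<close> is \<open>\<Sum>\<^sub>k sup\<^sub>K l\<^sub>k \<le> n\<^sup>2\<close>. The maximal such cubes are almost
  disjoint, whence \<open>\<Sum> |I| < n\<^sup>2 |Q| / A\<close>. The parent of a maximal cube is not one of them,
  which gives the factor \<open>2\<^sup>d\<close> in the first claim.\<close>

section \<open>Cubes and their dyadic subcubes\<close>

lemma emeasure_cube:
  fixes a :: "'a::euclidean_space"
  assumes "s \<ge> 0"
  shows "emeasure lebesgue (cube a s) = ennreal (s ^ DIM('a))"
proof -
  have "emeasure lebesgue (cube a s) = emeasure lborel (cube a s)"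
    unfolding cube_def by (simp add: emeasure_completion main_part)
  also have "\<dots> = ennreal (\<Prod>b\<in>(Basis::'a set). s)"
    unfolding cube_def using assms
    by (subst emeasure_lborel_cbox) (auto simp: inner_simps intro!: arg_cong[where f=ennreal] prod.cong)
  finally show ?thesis by simp
qed

lemma measure_cube:
  fixes a :: "'a::euclidean_space"
  assumes "s \<ge> 0"
  shows "measure lebesgue (cube a s) = s ^ DIM('a)"
  using emeasure_cube[OF assms, of a] assms unfolding measure_def by simp

lemma compact_cube: "compact (cube a s)"
  unfolding cube_def by simp

lemma mem_cube: "x \<in> cube c t \<longleftrightarrow> (\<forall>i\<in>Basis. c \<bullet> i \<le> x \<bullet> i \<and> x \<bullet> i \<le> c \<bullet> i + t)"
  unfolding cube_def mem_box by (simp add: inner_simps)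

lemma cube_eq_cube_iff:
  fixes a :: "'a::euclidean_space"
  assumes "s > 0" "t > 0"
  shows "cube a s = cube b t \<longleftrightarrow> a = b \<and> s = t"
proof
  assume eq: "cube a s = cube b t"
  have "cbox a (a + s *\<^sub>R One) \<noteq> {}"
    using assms by (auto simp: box_ne_empty inner_simps)
  then have corners: "a = b \<and> a + s *\<^sub>R One = b + t *\<^sub>R One"
    using eq unfolding cube_def eq_cbox by blast
  obtain i where "i \<in> (Basis::'a set)"
    using nonempty_Basis by blast
  with corners show "a = b \<and> s = t"
    using arg_cong[OF conjunct2[OF corners], of "\<lambda>x. x \<bullet> i"] by (simp add: inner_simps)
qed simp

definition dyadic_cube :: "'a::euclidean_space \<Rightarrow> real \<Rightarrow> nat \<Rightarrow> ('a \<Rightarrow> nat) \<Rightarrow> 'a set" where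
  "dyadic_cube a s k j = cube (a + (\<Sum>i\<in>Basis. (s / 2 ^ k * real (j i)) *\<^sub>R i)) (s / 2 ^ k)"

lemma dyadic_cube_0: "dyadic_cube a s 0 (\<lambda>_. 0) = cube a s"
  unfolding dyadic_cube_def by simp

lemma mem_dyadic_cube:
  "x \<in> dyadic_cube a s k j \<longleftrightarrow>
   (\<forall>i\<in>Basis. a \<bullet> i + s / 2 ^ k * real (j i) \<le> x \<bullet> i \<and> x \<bullet> i \<le> a \<bullet> i + s / 2 ^ k * (real (j i) + 1))"
  unfolding dyadic_cube_def mem_cube
  by (simp add: inner_add_left inner_sum_left inner_Basis if_distrib distrib_left add.assoc cong: if_cong)

lemma measure_dyadic_cube:
  fixes a :: "'a::euclidean_space"
  assumes "s \<ge> 0"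
  shows "measure lebesgue (dyadic_cube a s k j) = (s / 2 ^ k) ^ DIM('a)"
  unfolding dyadic_cube_def using assms by (simp add: measure_cube)

lemma dyadic_subcube_iff:
  fixes a :: "'a::euclidean_space"
  assumes "s > 0"
  shows "dyadic_subcube I (cube a s) \<longleftrightarrow>
    (\<exists>k j. (\<forall>i\<in>Basis. j i < (2::nat) ^ k) \<and> I = dyadic_cube a s k j)"
proof
  assume "dyadic_subcube I (cube a s)"
  then obtain a' s' k j where "s' > 0" "cube a s = cube a' s'" "\<forall>i\<in>Basis. j i < (2::nat) ^ k"
      "I = dyadic_cube a' s' k j"
    unfolding dyadic_subcube_def dyadic_cube_def by blast
  moreover from this(1,2) have "a' = a \<and> s' = s"
    using assms cube_eq_cube_iff by metis
  ultimately show "\<exists>k j. (\<forall>i\<in>Basis. j i < (2::nat) ^ k) \<and> I = dyadic_cube a s k j"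
    by blast
qed (use assms in \<open>auto simp: dyadic_subcube_def dyadic_cube_def\<close>)

lemma dyadic_subcubeE:
  assumes "dyadic_subcube I Q"
  obtains a s k j where "s > 0" "Q = cube a s" "\<forall>i\<in>Basis. j i < (2::nat) ^ k"
    "I = dyadic_cube a s k j"
  using assms unfolding dyadic_subcube_def dyadic_cube_def by blast

lemma dyadic_scale_eq:
  assumes "k \<le> l"
  shows "s / 2 ^ k = s / 2 ^ l * (2 ^ (l - k) :: real)"
  using assms by (simp add: field_simps flip: power_add)

lemma dyadic_cube_subset:
  fixes a :: "'a::euclidean_space"
  assumes "s \<ge> 0" "k \<le> l"
    and "\<forall>i\<in>Basis. j i * 2 ^ (l - k) \<le> j' i \<and> j' i < (j i + 1) * 2 ^ (l - k)"
  shows "dyadic_cube a s l j' \<subseteq> dyadic_cube a s k j"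
proof
  fix x assume x: "x \<in> dyadic_cube a s l j'"
  define t where "t = s / 2 ^ l"
  have "t \<ge> 0" using assms(1) by (simp add: t_def)
  show "x \<in> dyadic_cube a s k j"
    unfolding mem_dyadic_cube dyadic_scale_eq[OF assms(2), of s] t_def[symmetric]
  proof
    fix i :: 'a assume i: "i \<in> Basis"
    have "real (j i * 2 ^ (l - k)) \<le> real (j' i)" "real (j' i + 1) \<le> real ((j i + 1) * 2 ^ (l - k))"
      using assms(3) i by (simp_all only: of_nat_le_iff) (auto simp: Suc_le_eq)
    from mult_left_mono[OF this(1) \<open>t \<ge> 0\<close>] mult_left_mono[OF this(2) \<open>t \<ge> 0\<close>]
    have "t * 2 ^ (l - k) * real (j i) \<le> t * real (j' i)"
      "t * (real (j' i) + 1) \<le> t * 2 ^ (l - k) * (real (j i) + 1)"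
      by (simp_all add: algebra_simps)
    with x i show "a \<bullet> i + t * 2 ^ (l - k) * real (j i) \<le> x \<bullet> i \<and>
        x \<bullet> i \<le> a \<bullet> i + t * 2 ^ (l - k) * (real (j i) + 1)"
      unfolding mem_dyadic_cube t_def by fastforce
  qed
qed

lemma dyadic_cube_subset_cube:
  assumes "s \<ge> 0" "\<forall>i\<in>Basis. j i < (2::nat) ^ k"
  shows "dyadic_cube a s k j \<subseteq> cube a s"
  using dyadic_cube_subset[of s 0 k "\<lambda>_. 0" j a] assms by (simp add: dyadic_cube_0)

lemma dyadic_cube_Int_null:
  fixes a :: "'a::euclidean_space"
  assumes "s \<ge> 0" "k \<le> l" "i \<in> Basis"
    and "\<not> (j i * 2 ^ (l - k) \<le> j' i \<and> j' i < (j i + 1) * 2 ^ (l - k))"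
  shows "dyadic_cube a s k j \<inter> dyadic_cube a s l j' \<in> null_sets lebesgue"
proof -
  define t where "t = s / 2 ^ l"
  have "t \<ge> 0" using assms(1) by (simp add: t_def)
  let ?C = "dyadic_cube a s k j \<inter> dyadic_cube a s l j'"
  have mem: "a \<bullet> i + t * 2 ^ (l - k) * real (j i) \<le> x \<bullet> i"
    "x \<bullet> i \<le> a \<bullet> i + t * 2 ^ (l - k) * (real (j i) + 1)"
    "a \<bullet> i + t * real (j' i) \<le> x \<bullet> i" "x \<bullet> i \<le> a \<bullet> i + t * (real (j' i) + 1)"
    if "x \<in> ?C" for x
    using that assms(3) by (auto simp: mem_dyadic_cube dyadic_scale_eq[OF assms(2), of s] t_def[symmetric])
  from assms(4) consider "j' i + 1 \<le> j i * 2 ^ (l - k)" | "(j i + 1) * 2 ^ (l - k) \<le> j' i"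
    by linarith
  then obtain c where "?C \<subseteq> {x. x \<bullet> i = c}"
  proof cases
    case 1
    then have "real (j' i + 1) \<le> real (j i * 2 ^ (l - k))" by (simp only: of_nat_le_iff)
    from mult_left_mono[OF this \<open>t \<ge> 0\<close>]
    have "t * (real (j' i) + 1) \<le> t * 2 ^ (l - k) * real (j i)" by (simp add: algebra_simps)
    with mem have "?C \<subseteq> {x. x \<bullet> i = a \<bullet> i + t * 2 ^ (l - k) * real (j i)}" by fastforce
    then show thesis by (rule that)
  next
    case 2
    then have "real ((j i + 1) * 2 ^ (l - k)) \<le> real (j' i)" by (simp only: of_nat_le_iff)
    from mult_left_mono[OF this \<open>t \<ge> 0\<close>]
    have "t * 2 ^ (l - k) * (real (j i) + 1) \<le> t * real (j' i)" by (simp add: algebra_simps)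
    with mem have "?C \<subseteq> {x. x \<bullet> i = a \<bullet> i + t * 2 ^ (l - k) * (real (j i) + 1)}" by fastforce
    then show thesis by (rule that)
  qed
  then have "negligible ?C"
    using negligible_standard_hyperplane[OF assms(3)] negligible_subset by blast
  then show ?thesis by (simp add: negligible_iff_null_sets)
qed

lemma dyadic_subcubeD:
  assumes "dyadic_subcube I Q"
  shows "I \<subseteq> Q" "compact I" "measure lebesgue I > 0" "I \<in> lmeasurable"
proof -
  obtain a s k j where s: "s > 0" and Q: "Q = cube a s" and jb: "\<forall>i\<in>Basis. j i < (2::nat) ^ k"
    and I: "I = dyadic_cube a s k j"
    using assms by (rule dyadic_subcubeE)
  show "I \<subseteq> Q" using dyadic_cube_subset_cube[OF _ jb] s I Q by simp
  show "compact I" unfolding I dyadic_cube_def by (rule compact_cube)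
  then show "I \<in> lmeasurable" by (rule lmeasurable_compact)
  show "measure lebesgue I > 0" unfolding I measure_dyadic_cube[OF less_imp_le[OF s]] using s by simp
qed

lemma dyadic_subcube_nested_or_null:
  assumes "dyadic_subcube I Q" "dyadic_subcube J Q"
  shows "I \<subseteq> J \<or> J \<subseteq> I \<or> I \<inter> J \<in> null_sets lebesgue"
proof -
  obtain a s k j where s: "s > 0" and Q: "Q = cube a s" and I: "I = dyadic_cube a s k j"
    using assms(1) by (rule dyadic_subcubeE)
  obtain l j' where J: "J = dyadic_cube a s l j'"
    using assms(2) dyadic_subcube_iff[OF s] Q by blast
  show ?thesis
  proof (cases "k \<le> l")
    case True
    then show ?thesis
      using dyadic_cube_subset[of s k l j j' a] dyadic_cube_Int_null[of s k l _ j j' a] s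
      unfolding I J by fastforce
  next
    case False
    then show ?thesis
      using dyadic_cube_subset[of s l k j' j a] dyadic_cube_Int_null[of s l k _ j' j a] s
      unfolding I J by (fastforce simp: Int_commute)
  qed
qed

lemma dyadic_subcube_parent:
  assumes "dyadic_subcube I Q" "I \<noteq> Q"
  obtains J where "dyadic_subcube J Q" "I \<subset> J"
    "measure lebesgue J = 2 ^ DIM('a) * measure lebesgue (I :: 'a::euclidean_space set)"
proof -
  obtain a s k j where s: "s > 0" and Q: "Q = cube a s" and jb: "\<forall>i\<in>Basis. j i < (2::nat) ^ k"
    and I: "I = dyadic_cube a s k j"
    using assms(1) by (rule dyadic_subcubeE)
  have "k \<noteq> 0"
  proof
    assume "k = 0"
    then have "\<forall>i\<in>Basis. j i = 0" using jb by simp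
    with \<open>k = 0\<close> have "I = Q" by (simp add: I Q dyadic_cube_def)
    with assms(2) show False ..
  qed
  then obtain k' where k: "k = Suc k'"
    by (cases k) auto
  define J where "J = dyadic_cube a s k' (\<lambda>i. j i div 2)"
  have "\<forall>i\<in>Basis. j i div 2 < 2 ^ k'"
    using jb k by (auto simp: div_less_iff_less_mult mult.commute)
  then have "dyadic_subcube J Q"
    unfolding J_def Q dyadic_subcube_iff[OF s] by (intro exI conjI) (assumption, rule refl)
  moreover have "I \<subseteq> J"
    unfolding I J_def using s k by (intro dyadic_cube_subset) auto
  moreover have mJ: "measure lebesgue J = 2 ^ DIM('a) * measure lebesgue I"
    unfolding I J_def measure_dyadic_cube[OF less_imp_le[OF s]] k
    by (simp flip: power_mult_distrib)
  moreover have "1 * measure lebesgue I < measure lebesgue J"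
    unfolding mJ using dyadic_subcubeD(3)[OF assms(1)]
    by (intro mult_strict_right_mono one_less_power) auto
  then have "I \<noteq> J"
    by auto
  ultimately show thesis by (intro that) auto
qed

lemma dyadic_subcube_refl: "is_cube Q \<Longrightarrow> dyadic_subcube Q Q"
  unfolding is_cube_def using dyadic_subcube_iff dyadic_cube_0 by fastforce

section \<open>Convex-body averages\<close>

text \<open>The weights \<open>\<phi> \<in> \<Phi>(S)\<close> occurring in \<open>cavg\<close>.\<close>

definition unit_weight :: "'a::euclidean_space set \<Rightarrow> ('a \<Rightarrow> real) \<Rightarrow> bool" where
  "unit_weight S \<phi> \<longleftrightarrow> \<phi> \<in> borel_measurable lebesgue \<and> (\<forall>x. \<bar>\<phi> x\<bar> \<le> 1) \<and> (\<forall>x. x \<notin> S \<longrightarrow> \<phi> x = 0)"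

lemma cavg_eq_unit_weight:
  "cavg f S = {(1 / measure lebesgue S) *\<^sub>R (LINT x|lebesgue. \<phi> x *\<^sub>R f x) | \<phi>. unit_weight S \<phi>}"
  unfolding cavg_def unit_weight_def by simp

lemma integrable_indicator_L1_loc:
  "L1_loc f \<Longrightarrow> compact S \<Longrightarrow> integrable lebesgue (\<lambda>x. indicator S x *\<^sub>R f x)"
  unfolding L1_loc_def set_integrable_def by blast

lemma integrable_unit_weight:
  assumes "L1_loc f" "compact S" "unit_weight S \<phi>"
  shows "integrable lebesgue (\<lambda>x. \<phi> x *\<^sub>R f x)"
proof -
  let ?g = "\<lambda>x. indicator S x *\<^sub>R f x"
  have g: "integrable lebesgue ?g"
    using assms(1,2) by (rule integrable_indicator_L1_loc)
  have "\<phi> x *\<^sub>R f x = \<phi> x *\<^sub>R ?g x" for x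
    using assms(3) unfolding unit_weight_def by (cases "x \<in> S") auto
  then have eq: "(\<lambda>x. \<phi> x *\<^sub>R f x) = (\<lambda>x. \<phi> x *\<^sub>R ?g x)" ..
  show ?thesis
    unfolding eq
  proof (rule Bochner_Integration.integrable_bound[OF g])
    show "(\<lambda>x. \<phi> x *\<^sub>R ?g x) \<in> borel_measurable lebesgue"
      using assms(3) unfolding unit_weight_def
      by (intro borel_measurable_scaleR[OF _ borel_measurable_integrable[OF g]]) simp
    show "AE x in lebesgue. norm (\<phi> x *\<^sub>R ?g x) \<le> norm (?g x)"
      using assms(3) unfolding unit_weight_def
      by (intro AE_I2) (auto simp: indicator_def intro!: mult_left_le_one_le)
  qed
qed

lemma integrable_indicator_abs_linear:
  fixes l :: "'b::euclidean_space \<Rightarrow> real" and f :: "'a::euclidean_space \<Rightarrow> 'b"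
  assumes "linear l" "L1_loc f" "compact S"
  shows "integrable lebesgue (\<lambda>x. indicator S x * \<bar>l (f x)\<bar>)"
proof -
  have "bounded_linear l"
    using assms(1) by (simp add: linear_conv_bounded_linear)
  then have "integrable lebesgue (\<lambda>x. l (indicator S x *\<^sub>R f x))"
    by (rule integrable_bounded_linear) (rule integrable_indicator_L1_loc[OF assms(2,3)])
  then have "integrable lebesgue (\<lambda>x. \<bar>l (indicator S x *\<^sub>R f x)\<bar>)"
    by (rule integrable_abs)
  moreover have "\<bar>l (indicator S x *\<^sub>R f x)\<bar> = indicator S x * \<bar>l (f x)\<bar>" for x
    by (simp add: linear_scale[OF assms(1)] abs_mult)
  ultimately show ?thesis by simp
qed

lemma linear_cavg_le:
  fixes l :: "'b::euclidean_space \<Rightarrow> real" and f :: "'a::euclidean_space \<Rightarrow> 'b"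
  assumes "linear l" "L1_loc f" "compact S" "y \<in> cavg f S"
  shows "\<bar>l y\<bar> \<le> (LINT x|lebesgue. indicator S x * \<bar>l (f x)\<bar>) / measure lebesgue S"
proof -
  obtain \<phi> where \<phi>: "unit_weight S \<phi>" and y: "y = (1 / measure lebesgue S) *\<^sub>R (LINT x|lebesgue. \<phi> x *\<^sub>R f x)"
    using assms(4) unfolding cavg_eq_unit_weight by blast
  have bl: "bounded_linear l"
    using assms(1) by (simp add: linear_conv_bounded_linear)
  have int: "integrable lebesgue (\<lambda>x. \<phi> x *\<^sub>R f x)"
    using assms(2,3) \<phi> by (rule integrable_unit_weight)
  have "l y = (LINT x|lebesgue. \<phi> x * l (f x)) / measure lebesgue S"
    unfolding y by (simp add: linear_scale[OF assms(1)] integral_bounded_linear[OF bl int, symmetric])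
  moreover have "\<bar>LINT x|lebesgue. \<phi> x * l (f x)\<bar> \<le> (LINT x|lebesgue. indicator S x * \<bar>l (f x)\<bar>)"
  proof (rule integral_abs_bound_integral)
    show "integrable lebesgue (\<lambda>x. \<phi> x * l (f x))"
      using integrable_bounded_linear[OF bl int] by (simp add: linear_scale[OF assms(1)])
    show "integrable lebesgue (\<lambda>x. indicator S x * \<bar>l (f x)\<bar>)"
      using assms(1-3) by (rule integrable_indicator_abs_linear)
    show "\<bar>\<phi> x * l (f x)\<bar> \<le> indicator S x * \<bar>l (f x)\<bar>" for x
      using \<phi> unfolding unit_weight_def by (cases "x \<in> S") (auto simp: abs_mult intro!: mult_left_le_one_le)
  qed
  ultimately show ?thesis
    by (simp add: abs_divide divide_right_mono)
qed

lemma linear_cavg_attains: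
  fixes l :: "'b::euclidean_space \<Rightarrow> real" and f :: "'a::euclidean_space \<Rightarrow> 'b"
  assumes "linear l" "L1_loc f" "compact S"
  obtains y where "y \<in> cavg f S" "l y = (LINT x|lebesgue. indicator S x * \<bar>l (f x)\<bar>) / measure lebesgue S"
proof -
  let ?g = "\<lambda>x. indicator S x *\<^sub>R f x"
  define \<phi> where "\<phi> x = sgn (l (?g x))" for x
  have bl: "bounded_linear l"
    using assms(1) by (simp add: linear_conv_bounded_linear)
  have "(\<lambda>x. l (?g x)) \<in> borel_measurable lebesgue"
    using assms by (intro borel_measurable_integrable integrable_bounded_linear[OF bl] integrable_indicator_L1_loc)
  then have "unit_weight S \<phi>"
    unfolding unit_weight_def \<phi>_def by (auto simp: sgn_real_def linear_0[OF assms(1)])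
  moreover have "l (f x) * sgn (l (indicator S x *\<^sub>R f x)) = indicator S x * \<bar>l (f x)\<bar>" for x
    by (simp add: linear_scale[OF assms(1)] sgn_mult abs_sgn indicator_def)
  then have "l ((1 / measure lebesgue S) *\<^sub>R (LINT x|lebesgue. \<phi> x *\<^sub>R f x)) =
      (LINT x|lebesgue. indicator S x * \<bar>l (f x)\<bar>) / measure lebesgue S"
    using integral_bounded_linear[OF bl integrable_unit_weight[OF assms(2,3) calculation]]
    by (simp add: linear_scale[OF assms(1)] \<phi>_def mult.commute)
  ultimately show thesis
    by (intro that[of "(1 / measure lebesgue S) *\<^sub>R (LINT x|lebesgue. \<phi> x *\<^sub>R f x)"])
      (auto simp: cavg_eq_unit_weight)
qed

lemma cavg_subset_scaleR:
  assumes "I \<subseteq> J" "measure lebesgue I > 0" "measure lebesgue J > 0"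
  shows "cavg f I \<subseteq> (*\<^sub>R) (measure lebesgue J / measure lebesgue I) ` cavg f J"
proof
  fix y assume "y \<in> cavg f I"
  then obtain \<phi> where \<phi>: "unit_weight I \<phi>"
    and y: "y = (1 / measure lebesgue I) *\<^sub>R (LINT x|lebesgue. \<phi> x *\<^sub>R f x)"
    unfolding cavg_eq_unit_weight by blast
  have "unit_weight J \<phi>"
    using \<phi> assms(1) unfolding unit_weight_def by auto
  then have "(1 / measure lebesgue J) *\<^sub>R (LINT x|lebesgue. \<phi> x *\<^sub>R f x) \<in> cavg f J"
    unfolding cavg_eq_unit_weight by blast
  moreover have "y = (measure lebesgue J / measure lebesgue I) *\<^sub>R
      ((1 / measure lebesgue J) *\<^sub>R (LINT x|lebesgue. \<phi> x *\<^sub>R f x))"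
    unfolding y using assms(3) by simp
  ultimately show "y \<in> (*\<^sub>R) (measure lebesgue J / measure lebesgue I) ` cavg f J"
    by blast
qed

lemma cavg_abs_combination:
  fixes f :: "'a::euclidean_space \<Rightarrow> 'b::euclidean_space" and y :: "'i \<Rightarrow> 'b"
  assumes "L1_loc f" "compact S" "finite T" "\<forall>k\<in>T. y k \<in> cavg f S" "(\<Sum>k\<in>T. \<bar>c k\<bar>) \<le> 1"
  shows "(\<Sum>k\<in>T. c k *\<^sub>R y k) \<in> cavg f S"
proof -
  have "\<forall>k\<in>T. \<exists>\<phi>. unit_weight S \<phi> \<and> y k = (1 / measure lebesgue S) *\<^sub>R (LINT x|lebesgue. \<phi> x *\<^sub>R f x)"
    using assms(4) unfolding cavg_eq_unit_weight by blast
  then obtain \<Phi> where \<Phi>: "\<And>k. k \<in> T \<Longrightarrow> unit_weight S (\<Phi> k)"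
    "\<And>k. k \<in> T \<Longrightarrow> y k = (1 / measure lebesgue S) *\<^sub>R (LINT x|lebesgue. \<Phi> k x *\<^sub>R f x)"
    by metis
  define \<psi> where "\<psi> x = (\<Sum>k\<in>T. c k * \<Phi> k x)" for x
  have "\<bar>\<psi> x\<bar> \<le> 1" for x
  proof -
    have "\<bar>\<psi> x\<bar> \<le> (\<Sum>k\<in>T. \<bar>c k\<bar> * \<bar>\<Phi> k x\<bar>)"
      unfolding \<psi>_def abs_mult[symmetric] by (rule sum_abs)
    also have "\<dots> \<le> (\<Sum>k\<in>T. \<bar>c k\<bar>)"
      using \<Phi>(1) unfolding unit_weight_def by (intro sum_mono mult_right_le_one_le) auto
    finally show ?thesis using assms(5) by linarith
  qed
  then have weight: "unit_weight S \<psi>"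
    using \<Phi>(1) unfolding unit_weight_def \<psi>_def
    by (auto intro!: borel_measurable_sum borel_measurable_times)
  have "(LINT x|lebesgue. \<psi> x *\<^sub>R f x) = (LINT x|lebesgue. (\<Sum>k\<in>T. c k *\<^sub>R (\<Phi> k x *\<^sub>R f x)))"
    unfolding \<psi>_def by (simp add: scaleR_sum_left)
  also have "\<dots> = (\<Sum>k\<in>T. (LINT x|lebesgue. c k *\<^sub>R (\<Phi> k x *\<^sub>R f x)))"
    by (intro Bochner_Integration.integral_sum integrable_scaleR_right integrable_unit_weight[OF assms(1,2) \<Phi>(1)])
  also have "\<dots> = (\<Sum>k\<in>T. c k *\<^sub>R (LINT x|lebesgue. \<Phi> k x *\<^sub>R f x))"
    by (simp only: integral_scaleR_right)
  finally have "(\<Sum>k\<in>T. c k *\<^sub>R y k) = (1 / measure lebesgue S) *\<^sub>R (LINT x|lebesgue. \<psi> x *\<^sub>R f x)"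
    using \<Phi>(2) by (simp add: scaleR_sum_right)
  with weight show ?thesis
    unfolding cavg_eq_unit_weight by blast
qed

lemma cavg_subset_dilation:
  assumes "L1_loc f" "compact S" "A \<ge> 1"
  shows "cavg f S \<subseteq> (*\<^sub>R) A ` cavg f S"
proof
  fix y assume "y \<in> cavg f S"
  then have "(1 / A) *\<^sub>R y \<in> cavg f S"
    using cavg_abs_combination[OF assms(1,2), of "{()}" "\<lambda>_. y" "\<lambda>_. 1 / A"] assms(3) by simp
  moreover have "y = A *\<^sub>R ((1 / A) *\<^sub>R y)"
    using assms(3) by simp
  ultimately show "y \<in> (*\<^sub>R) A ` cavg f S"
    by blast
qed

lemma bounded_cavg:
  fixes f :: "'a::euclidean_space \<Rightarrow> 'b::euclidean_space"
  assumes "L1_loc f" "compact S"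
  shows "bounded (cavg f S)"
  unfolding bounded_iff
proof (intro exI ballI)
  fix y assume y: "y \<in> cavg f S"
  have "norm y \<le> (\<Sum>b\<in>Basis. \<bar>y \<bullet> b\<bar>)"
    by (rule norm_le_l1)
  also have "\<dots> \<le> (\<Sum>b\<in>Basis. (LINT x|lebesgue. indicator S x * \<bar>f x \<bullet> b\<bar>) / measure lebesgue S)"
  proof (rule sum_mono)
    fix b :: 'b
    have "linear (\<lambda>z. z \<bullet> b)"
      by (simp add: bounded_linear_inner_left bounded_linear.linear)
    then show "\<bar>y \<bullet> b\<bar> \<le> (LINT x|lebesgue. indicator S x * \<bar>f x \<bullet> b\<bar>) / measure lebesgue S"
      using linear_cavg_le[OF _ assms y] by blast
  qed
  finally show "norm y \<le> (\<Sum>b\<in>(Basis::'b set). (LINT x|lebesgue. indicator S x * \<bar>f x \<bullet> b\<bar>) / measure lebesgue S)" .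
qed

lemma integral_indicator_sum_abs_linear:
  fixes l :: "nat \<Rightarrow> 'b::euclidean_space \<Rightarrow> real" and f :: "'a::euclidean_space \<Rightarrow> 'b"
  assumes "\<forall>k<m. linear (l k)" "L1_loc f" "compact S"
  shows "integrable lebesgue (\<lambda>x. indicator S x * (\<Sum>k<m. \<bar>l k (f x)\<bar>))"
    and "(LINT x|lebesgue. indicator S x * (\<Sum>k<m. \<bar>l k (f x)\<bar>)) =
      (\<Sum>k<m. LINT x|lebesgue. indicator S x * \<bar>l k (f x)\<bar>)"
proof -
  have "\<And>k. k \<in> {..<m} \<Longrightarrow> integrable lebesgue (\<lambda>x. indicator S x * \<bar>l k (f x)\<bar>)"
    using assms by (auto intro: integrable_indicator_abs_linear)
  then show "integrable lebesgue (\<lambda>x. indicator S x * (\<Sum>k<m. \<bar>l k (f x)\<bar>))"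
    unfolding sum_distrib_left by (rule Bochner_Integration.integrable_sum)
  show "(LINT x|lebesgue. indicator S x * (\<Sum>k<m. \<bar>l k (f x)\<bar>)) =
      (\<Sum>k<m. LINT x|lebesgue. indicator S x * \<bar>l k (f x)\<bar>)"
    unfolding sum_distrib_left by (rule Bochner_Integration.integral_sum) fact
qed

section \<open>Determinants of matrices given by their entries\<close>

definition det_entries :: "nat \<Rightarrow> (nat \<Rightarrow> nat \<Rightarrow> real) \<Rightarrow> real" where
  "det_entries m r = Determinant.det (Matrix.mat m m (\<lambda>(i,j). r i j))"

lemma det_entries_leibniz:
  "det_entries m r = (\<Sum>p | p permutes {0..<m}. of_int (sign p) * (\<Prod>i = 0..<m. r i (p i)))"
  unfolding det_entries_def det_def'[OF mat_carrier]
proof (rule sum.cong[OF refl])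
  fix p assume "p \<in> {p. p permutes {0..<m}}"
  then have p: "p permutes {0..<m}" by simp
  have "i < m \<Longrightarrow> p i < m" for i using permutes_in_image[OF p, of i] by simp
  then show "of_int (sign p) * (\<Prod>i = 0..<m. Matrix.mat m m (\<lambda>(i, j). r i j) $$ (i, p i)) =
        of_int (sign p) * (\<Prod>i = 0..<m. r i (p i))"
    by (intro arg_cong2[where f="(*)"] refl prod.cong) auto
qed

lemma det_entries_cong:
  assumes "\<And>i j. i < m \<Longrightarrow> j < m \<Longrightarrow> r i j = r' i j"
  shows "det_entries m r = det_entries m r'"
  unfolding det_entries_leibniz
proof (rule sum.cong[OF refl])
  fix p assume "p \<in> {p. p permutes {0..<m}}"
  then have p: "p permutes {0..<m}" by simp
  have "i < m \<Longrightarrow> p i < m" for i using permutes_in_image[OF p, of i] by simp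
  then show "of_int (sign p) * (\<Prod>i = 0..<m. r i (p i)) = of_int (sign p) * (\<Prod>i = 0..<m. r' i (p i))"
    using assms by (intro arg_cong2[where f="(*)"] refl prod.cong) auto
qed

lemma det_entries_row_sum:
  assumes "finite L" "k < m"
  shows "det_entries m (r(k := (\<lambda>j. \<Sum>l\<in>L. c l * s l j))) = (\<Sum>l\<in>L. c l * det_entries m (r(k := s l)))"
proof -
  define R where "R p = (\<Prod>i\<in>{0..<m} - {k}. r i (p i))" for p :: "nat \<Rightarrow> nat"
  have pr: "(\<Prod>i = 0..<m. (r(k := X)) i (p i)) = X (p k) * R p" for X p
  proof -
    have "(\<Prod>i = 0..<m. (r(k := X)) i (p i)) = (r(k := X)) k (p k) * (\<Prod>i\<in>{0..<m} - {k}. (r(k := X)) i (p i))"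
      by (rule prod.remove) (use assms(2) in auto)
    also have "(\<Prod>i\<in>{0..<m} - {k}. (r(k := X)) i (p i)) = R p" unfolding R_def by (rule prod.cong) auto
    finally show ?thesis by simp
  qed
  let ?P = "{p. p permutes {0..<m}}"
  have "det_entries m (r(k := (\<lambda>j. \<Sum>l\<in>L. c l * s l j))) = (\<Sum>p\<in>?P. of_int (sign p) * ((\<Sum>l\<in>L. c l * s l (p k)) * R p))"
    unfolding det_entries_leibniz pr ..
  also have "\<dots> = (\<Sum>p\<in>?P. \<Sum>l\<in>L. c l * (of_int (sign p) * (s l (p k) * R p)))"
    by (rule sum.cong[OF refl]) (simp add: sum_distrib_left sum_distrib_right mult_ac)
  also have "\<dots> = (\<Sum>l\<in>L. \<Sum>p\<in>?P. c l * (of_int (sign p) * (s l (p k) * R p)))"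
    by (rule sum.swap)
  also have "\<dots> = (\<Sum>l\<in>L. c l * det_entries m (r(k := s l)))"
    unfolding det_entries_leibniz pr by (simp add: sum_distrib_left)
  finally show ?thesis .
qed

lemma det_entries_identical_rows:
  assumes "k < m" "l < m" "k \<noteq> l" "\<And>j. j < m \<Longrightarrow> r k j = r l j"
  shows "det_entries m r = 0"
  unfolding det_entries_def
proof (rule det_identical_rows[OF mat_carrier assms(3,1,2)])
  show "Matrix.row (Matrix.mat m m (\<lambda>(i, j). r i j)) k = Matrix.row (Matrix.mat m m (\<lambda>(i, j). r i j)) l"
    using assms by (intro eq_vecI) auto
qed

lemma det_entries_row_combination:
  assumes "k < m"
  shows "det_entries m (r(k := (\<lambda>j. \<Sum>l<m. c l * r l j))) = c k * det_entries m r"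
proof -
  have "det_entries m (r(k := (\<lambda>j. \<Sum>l<m. c l * r l j))) = (\<Sum>l<m. c l * det_entries m (r(k := r l)))"
    by (rule det_entries_row_sum) (use assms in auto)
  also have "\<dots> = (\<Sum>l<m. if l = k then c k * det_entries m r else 0)"
  proof (rule sum.cong[OF refl])
    fix l assume l: "l \<in> {..<m}"
    show "c l * det_entries m (r(k := r l)) = (if l = k then c k * det_entries m r else 0)"
    proof (cases "l = k")
      case True then show ?thesis by simp
    next
      case False
      have "det_entries m (r(k := r l)) = 0" by (rule det_entries_identical_rows[of k m l]) (use assms l False in auto)
      then show ?thesis using False by simp
    qed
  qed
  also have "\<dots> = c k * det_entries m r" using assms by simp
  finally show ?thesis .
qed

lemma det_entries_id: "det_entries m (\<lambda>i j. if i = j then 1 else 0) = 1"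
proof -
  have "Matrix.mat m m (\<lambda>(i, j). if i = j then 1 else 0) = (1\<^sub>m m :: real mat)" by (intro eq_matI) auto
  then show ?thesis unfolding det_entries_def by simp
qed

lemma abs_det_entries_le:
  assumes "\<And>i j. i < m \<Longrightarrow> j < m \<Longrightarrow> \<bar>r i j\<bar> \<le> G"
  shows "\<bar>det_entries m r\<bar> \<le> real (card {p. p permutes {0..<m}}) * G ^ m"
proof -
  let ?P = "{p. p permutes {0..<m}}"
  have "\<bar>det_entries m r\<bar> \<le> (\<Sum>p\<in>?P. \<bar>of_int (sign p) * (\<Prod>i = 0..<m. r i (p i))\<bar>)"
    unfolding det_entries_leibniz by (rule sum_abs)
  also have "\<dots> \<le> (\<Sum>p\<in>?P. G ^ m)"
  proof (rule sum_mono)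
    fix p assume "p \<in> ?P"
    then have p: "p permutes {0..<m}" by simp
    have pi: "i < m \<Longrightarrow> p i < m" for i using permutes_in_image[OF p, of i] by simp
    have "\<bar>of_int (sign p) * (\<Prod>i = 0..<m. r i (p i))\<bar> = (\<Prod>i = 0..<m. \<bar>r i (p i)\<bar>)"
      by (simp add: abs_mult abs_prod sign_def)
    also have "\<dots> \<le> (\<Prod>i = 0..<m. G)"
      by (rule prod_mono) (use assms pi in auto)
    also have "\<dots> = G ^ m" by simp
    finally show "\<bar>of_int (sign p) * (\<Prod>i = 0..<m. r i (p i))\<bar> \<le> G ^ m" .
  qed
  also have "\<dots> = real (card ?P) * G ^ m" by simp
  finally show ?thesis .
qed

section \<open>Dual frames\<close>

definition dual_frame :: "'b::real_vector set \<Rightarrow> nat \<Rightarrow> (nat \<Rightarrow> 'b \<Rightarrow> real) \<Rightarrow> (nat \<Rightarrow> 'b) \<Rightarrow> bool" where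
  "dual_frame K m l v \<longleftrightarrow>
    (\<forall>k<m. linear (l k)) \<and> (\<forall>k<m. v k \<in> K) \<and> (\<forall>y\<in>span K. y = (\<Sum>k<m. l k y *\<^sub>R v k))"

definition gram_det :: "(nat \<Rightarrow> 'b \<Rightarrow> real) \<Rightarrow> nat \<Rightarrow> (nat \<Rightarrow> 'b) \<Rightarrow> real" where
  "gram_det G m w = det_entries m (\<lambda>i j. G j (w i))"

lemma gram_det_update_combination:
  assumes "\<And>j. linear (G j)" "k < m"
  shows "gram_det G m (w(k := \<Sum>j<m. c j *\<^sub>R w j)) = c k * gram_det G m w"
proof -
  let ?r = "\<lambda>i j. G j (w i)"
  have "gram_det G m (w(k := \<Sum>j<m. c j *\<^sub>R w j)) = det_entries m (?r(k := (\<lambda>j. \<Sum>l<m. c l * ?r l j)))"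
    unfolding gram_det_def by (rule det_entries_cong) (simp add: linear_sum[OF assms(1)] linear_scale[OF assms(1)])
  also have "\<dots> = c k * gram_det G m w"
    unfolding gram_det_def by (rule det_entries_row_combination[OF assms(2)])
  finally show ?thesis .
qed

lemma gram_det_eq_0_if_combination:
  assumes "\<And>j. linear (G j)" "k < m" "c k = 0" "w k = (\<Sum>j<m. c j *\<^sub>R w j)"
  shows "gram_det G m w = 0"
proof -
  have "gram_det G m w = gram_det G m (w(k := \<Sum>j<m. c j *\<^sub>R w j))"
    using assms(4) by (simp only: fun_upd_idem)
  also have "\<dots> = 0"
    using gram_det_update_combination[OF assms(1,2)] assms(3) by simp
  finally show ?thesis .
qed

lemma gram_det_nonzero_independent:
  assumes G: "\<And>j. linear (G j)" and D: "gram_det G m w \<noteq> 0"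
  shows "inj_on w {..<m}" "independent (w ` {..<m})"
proof -
  have no_comb: "w k \<noteq> (\<Sum>j<m. c j *\<^sub>R w j)" if "k < m" "c k = 0" for k c
    using gram_det_eq_0_if_combination[where G=G and c=c and k=k, OF G that] D by blast
  show inj: "inj_on w {..<m}"
  proof (rule inj_onI, rule ccontr)
    fix i k assume ik: "i \<in> {..<m}" "k \<in> {..<m}" "w i = w k" "i \<noteq> k"
    have "(\<Sum>j<m. (if j = i then 1 else 0) *\<^sub>R w j) = (\<Sum>j<m. if j = i then w j else 0)"
      by (rule sum.cong) auto
    also have "\<dots> = w k"
      using ik by simp
    finally show False
      using no_comb[of k "\<lambda>j. if j = i then 1 else 0"] ik by auto
  qed
  show "independent (w ` {..<m})"
  proof
    assume "dependent (w ` {..<m})"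
    then obtain k where k: "k < m" "w k \<in> span (w ` {..<m} - {w k})"
      unfolding dependent_def by blast
    have inj': "inj_on w ({..<m} - {k})"
      using inj by (rule inj_on_subset) auto
    have "w ` {..<m} - {w k} = w ` ({..<m} - {k})"
      using inj k(1) unfolding inj_on_def by auto
    then have "w k \<in> range (\<lambda>c. \<Sum>b\<in>w ` ({..<m} - {k}). c b *\<^sub>R b)"
      using k(2) span_finite[OF finite_imageI[OF finite_Diff[OF finite_lessThan]], of w m "{k}"] by simp
    then obtain c where "w k = (\<Sum>b\<in>w ` ({..<m} - {k}). c b *\<^sub>R b)"
      by blast
    also have "\<dots> = (\<Sum>j\<in>{..<m} - {k}. c (w j) *\<^sub>R w j)"
      by (simp only: sum.reindex[OF inj'] o_def)
    also have "\<dots> = (\<Sum>j<m. (if j = k then 0 else c (w j)) *\<^sub>R w j)"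
      using k(1) by (intro sum.mono_neutral_cong_left) auto
    finally show False
      using no_comb[OF k(1)] by simp
  qed
qed

lemma dual_functionals_exist:
  fixes w :: "nat \<Rightarrow> 'b::real_vector"
  assumes "independent (w ` {..<m})" "inj_on w {..<m}"
  obtains G where "\<And>j. linear (G j)"
    "\<And>i j. i < m \<Longrightarrow> j < m \<Longrightarrow> G j (w i) = (if i = j then 1 else (0::real))"
proof -
  have "\<exists>g. linear g \<and> (\<forall>x\<in>w ` {..<m}. g x = (if x = w j then 1 else (0::real)))" for j
    by (rule linear_independent_extend[OF assms(1)])
  then have "\<forall>j. \<exists>g. linear g \<and> (\<forall>x\<in>w ` {..<m}. g x = (if x = w j then 1 else (0::real)))"
    by blast
  from choice[OF this] obtain G
    where "\<forall>j. linear (G j) \<and> (\<forall>x\<in>w ` {..<m}. G j x = (if x = w j then 1 else (0::real)))"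
    by blast
  with assms(2) show thesis
    by (intro that) (auto simp: inj_on_eq_iff)
qed

lemma dual_expansion:
  fixes w :: "nat \<Rightarrow> 'b::real_vector"
  assumes "inj_on w {..<m}" "\<And>j. linear (G j)"
    and "\<And>i j. i < m \<Longrightarrow> j < m \<Longrightarrow> G j (w i) = (if i = j then 1 else 0)"
    and "y \<in> span (w ` {..<m})"
  shows "y = (\<Sum>j<m. G j y *\<^sub>R w j)"
proof -
  have "y \<in> range (\<lambda>c. \<Sum>b\<in>w ` {..<m}. c b *\<^sub>R b)"
    using assms(4) span_finite[OF finite_imageI[OF finite_lessThan], of w m] by simp
  then obtain c where "y = (\<Sum>b\<in>w ` {..<m}. c b *\<^sub>R b)"
    by blast
  then have y: "y = (\<Sum>i<m. c (w i) *\<^sub>R w i)"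
    using assms(1) by (simp add: sum.reindex)
  have "G j y = c (w j)" if "j < m" for j
  proof -
    have "G j y = (\<Sum>i<m. c (w i) * G j (w i))"
      by (subst y) (simp add: linear_sum[OF assms(2)] linear_scale[OF assms(2)])
    also have "\<dots> = (\<Sum>i<m. if i = j then c (w i) else 0)"
      using that assms(3) by (intro sum.cong) auto
    finally show ?thesis
      using that by simp
  qed
  then show ?thesis
    by (subst (1) y) simp
qed

lemma exists_half_maximizer:
  fixes g :: "'x \<Rightarrow> real"
  assumes "bdd_above (g ` W)" "w0 \<in> W" "g w0 > 0"
  obtains v where "v \<in> W" "\<And>w. w \<in> W \<Longrightarrow> g w \<le> 2 * g v"
proof -
  let ?S = "Sup (g ` W)"
  have le: "g w \<le> ?S" if "w \<in> W" for w
    using assms(1) that by (intro cSup_upper) auto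
  have "\<exists>v\<in>W. ?S / 2 < g v"
  proof (rule ccontr)
    assume "\<not> (\<exists>v\<in>W. ?S / 2 < g v)"
    then have "?S \<le> ?S / 2"
      using assms(2) by (intro cSup_least) (auto simp: not_less)
    with le[OF assms(2)] assms(3) show False by simp
  qed
  then obtain v where "v \<in> W" "?S / 2 < g v"
    by blast
  with le show thesis
    by (intro that[of v]) fastforce+
qed

text \<open>Auerbach's lemma with constant 2: the coefficient of \<open>y\<close> at \<open>v k\<close> is the ratio of the
  determinants of \<open>v(k := y)\<close> and \<open>v\<close>, so a maximiser up to the factor 2 suffices (the supremum
  need not be attained).\<close>

lemma near_maximizer_dual_frame:
  fixes K :: "'b::euclidean_space set"
  assumes G: "\<And>j. linear (G j)" and dim: "dim K = m" and v: "\<forall>i<m. v i \<in> K"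
    and D: "gram_det G m v \<noteq> 0"
    and max: "\<And>w. \<forall>i<m. w i \<in> K \<Longrightarrow> \<bar>gram_det G m w\<bar> \<le> 2 * \<bar>gram_det G m v\<bar>"
  obtains L where "dual_frame K m L v" "\<forall>k<m. \<forall>y\<in>K. \<bar>L k y\<bar> \<le> 2"
proof -
  note indep = gram_det_nonzero_independent[OF G D]
  have "v ` {..<m} \<subseteq> K"
    using v by auto
  moreover have "card (v ` {..<m}) = dim K"
    using card_image[OF indep(1)] dim by simp
  ultimately have "K \<subseteq> span (v ` {..<m})"
    using card_eq_dim[of "v ` {..<m}" K] indep(2) by blast
  then have span: "span K \<subseteq> span (v ` {..<m})"
    by (rule span_minimal[OF _ subspace_span])
  obtain L where L: "\<And>j. linear (L j)"
    "\<And>i j. i < m \<Longrightarrow> j < m \<Longrightarrow> L j (v i) = (if i = j then 1 else (0::real))"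
    using dual_functionals_exist[OF indep(2,1)] by blast
  have rep: "y = (\<Sum>j<m. L j y *\<^sub>R v j)" if "y \<in> span K" for y
    using dual_expansion[OF indep(1) L subsetD[OF span that]] .
  have bound: "\<bar>L k y\<bar> \<le> 2" if k: "k < m" and y: "y \<in> K" for k y
  proof -
    have "gram_det G m (v(k := y)) = L k y * gram_det G m v"
      using gram_det_update_combination[OF G k, where w=v and c="\<lambda>j. L j y"]
      by (simp only: rep[OF span_base[OF y], symmetric])
    moreover have "\<bar>gram_det G m (v(k := y))\<bar> \<le> 2 * \<bar>gram_det G m v\<bar>"
      using v y by (intro max) auto
    ultimately have "\<bar>L k y\<bar> * \<bar>gram_det G m v\<bar> \<le> 2 * \<bar>gram_det G m v\<bar>"
      by (simp add: abs_mult)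
    then show ?thesis
      by (rule mult_right_le_imp_le) (use D in simp)
  qed
  have "dual_frame K m L v"
    unfolding dual_frame_def using L(1) v by (intro conjI ballI rep) auto
  then show thesis
    using that bound by blast
qed

lemma bdd_above_gram_det:
  fixes K :: "'b::euclidean_space set"
  assumes "bounded K" "\<And>j. linear (G j)"
  shows "bdd_above ((\<lambda>w. \<bar>gram_det G m w\<bar>) ` {w. \<forall>i<m. w i \<in> K})"
proof -
  obtain R where R: "\<And>y. y \<in> K \<Longrightarrow> norm y \<le> R"
    using assms(1) unfolding bounded_iff by blast
  define C where "C = (\<Sum>j<m. onorm (G j)) * R"
  have "\<bar>G j y\<bar> \<le> C" if "y \<in> K" "j < m" for y j
  proof -
    have bl: "bounded_linear (G j')" for j'
      using assms(2) by (simp add: linear_conv_bounded_linear)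
    have "\<bar>G j y\<bar> \<le> onorm (G j) * norm y"
      using onorm[OF bl] by (metis real_norm_def)
    also have "\<dots> \<le> onorm (G j) * R"
      using R[OF that(1)] onorm_pos_le[OF bl] by (rule mult_left_mono)
    also have "\<dots> \<le> C"
      unfolding C_def using that(2) R[OF that(1)] onorm_pos_le[OF bl]
      by (intro mult_right_mono member_le_sum) (auto intro: order_trans[OF norm_ge_zero])
    finally show ?thesis .
  qed
  then show ?thesis
    unfolding gram_det_def
    by (intro bdd_aboveI2[where M="real (card {p. p permutes {0..<m}}) * C ^ m"] abs_det_entries_le) auto
qed

lemma auerbach_dual_frame:
  fixes K :: "'b::euclidean_space set"
  assumes "bounded K"
  obtains m l v where "m \<le> DIM('b)" "dual_frame K m l v" "\<forall>k<m. \<forall>y\<in>K. \<bar>l k y\<bar> \<le> 2"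
proof -
  obtain B where B: "B \<subseteq> K" "independent B" "K \<subseteq> span B"
    by (rule maximal_independent_subset)
  define m where "m = card B"
  have "finite B" "m \<le> DIM('b)"
    using independent_bound[OF B(2)] by (auto simp: m_def)
  then obtain u where u: "bij_betw u {..<m} B"
    using ex_bij_betw_nat_finite unfolding m_def atLeast0LessThan by blast
  have dim: "dim K = m"
    unfolding m_def using B span_superset by (intro dim_eq_card) (auto simp: span_eq)
  have "inj_on u {..<m}" "independent (u ` {..<m})" and uK: "u \<in> {w. \<forall>i<m. w i \<in> K}"
    using u B by (auto simp: bij_betw_def)
  then obtain G where G: "\<And>j. linear (G j)"
    "\<And>i j. i < m \<Longrightarrow> j < m \<Longrightarrow> G j (u i) = (if i = j then 1 else (0::real))"
    using dual_functionals_exist by blast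
  have "gram_det G m u = det_entries m (\<lambda>i j. if i = j then 1 else 0)"
    unfolding gram_det_def by (rule det_entries_cong) (simp add: G(2))
  then have Du: "\<bar>gram_det G m u\<bar> > 0"
    by (simp add: det_entries_id)
  obtain v where v: "\<forall>i<m. v i \<in> K"
    and max: "\<And>w. \<forall>i<m. w i \<in> K \<Longrightarrow> \<bar>gram_det G m w\<bar> \<le> 2 * \<bar>gram_det G m v\<bar>"
    using exists_half_maximizer[OF bdd_above_gram_det[where G=G and m=m, OF assms G(1)] uK] Du by auto
  have "gram_det G m v \<noteq> 0"
    using max uK Du by fastforce
  then obtain L where "dual_frame K m L v" "\<forall>k<m. \<forall>y\<in>K. \<bar>L k y\<bar> \<le> 2"
    using near_maximizer_dual_frame[where G=G, OF G(1) dim v _ max] by blast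
  with \<open>m \<le> DIM('b)\<close> show thesis
    by (rule that)
qed

lemma line_dual_frame:
  fixes K :: "'b::real_inner set"
  assumes "y0 \<in> K" "\<forall>y\<in>K. \<exists>t. \<bar>t\<bar> \<le> 1 \<and> y = t *\<^sub>R y0"
  obtains m l v where "m \<le> 1" "dual_frame K m l v" "\<forall>k<m. \<forall>y\<in>K. \<bar>l k y\<bar> \<le> 1"
proof (cases "y0 = 0")
  case True
  then have "span K \<subseteq> {0}"
    using assms(2) by (intro span_minimal) auto
  then have "dual_frame K 0 (\<lambda>_ _. 0) (\<lambda>_. 0)"
    unfolding dual_frame_def by auto
  then show thesis
    using that[of 0 "\<lambda>_ _. 0" "\<lambda>_. 0"] by simp
next
  case False
  define l where "l y = y \<bullet> ((1 / (y0 \<bullet> y0)) *\<^sub>R y0)" for y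
  have l: "l (t *\<^sub>R y0) = t" for t
    using False by (simp add: l_def)
  have "linear l"
    unfolding l_def by (rule bounded_linear.linear[OF bounded_linear_inner_left])
  moreover have "span K \<subseteq> span {y0}"
    using assms(2) by (intro span_minimal subspace_span) (auto simp: span_singleton)
  then have "y = l y *\<^sub>R y0" if "y \<in> span K" for y
    using that l by (auto simp: span_singleton)
  ultimately have "dual_frame K 1 (\<lambda>_. l) (\<lambda>_. y0)"
    unfolding dual_frame_def using assms(1) by auto
  moreover have "\<forall>y\<in>K. \<bar>l y\<bar> \<le> 1"
    using assms(2) l by fastforce
  ultimately show thesis
    by (intro that[of 1]) auto
qed

lemma cavg_segment:
  fixes f :: "'a::euclidean_space \<Rightarrow> 'b::euclidean_space"
  assumes "DIM('b) = 1" and f: "L1_loc f" and Q: "compact Q"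
  obtains y0 where "y0 \<in> cavg f Q" "\<forall>z\<in>cavg f Q. \<exists>t. \<bar>t\<bar> \<le> 1 \<and> z = t *\<^sub>R y0"
proof -
  obtain b :: 'b where b: "Basis = {b}"
    using assms(1) by (metis card_1_singletonE)
  have rep: "y = (y \<bullet> b) *\<^sub>R b" for y :: 'b
    using euclidean_representation[of y] by (simp add: b)
  have lin: "linear (\<lambda>y::'b. y \<bullet> b)"
    by (simp add: bounded_linear_inner_left bounded_linear.linear)
  define \<sigma> where "\<sigma> = (LINT x|lebesgue. indicator Q x * \<bar>f x \<bullet> b\<bar>) / measure lebesgue Q"
  obtain y0 where y0: "y0 \<in> cavg f Q" "y0 \<bullet> b = \<sigma>"
    unfolding \<sigma>_def by (rule linear_cavg_attains[OF lin f Q])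
  have le: "\<bar>z \<bullet> b\<bar> \<le> \<sigma>" if "z \<in> cavg f Q" for z
    unfolding \<sigma>_def using linear_cavg_le[OF lin f Q that] .
  have "\<exists>t. \<bar>t\<bar> \<le> 1 \<and> z = t *\<^sub>R y0" if "z \<in> cavg f Q" for z
  proof (cases "\<sigma> = 0")
    case True
    then show ?thesis
      using le[OF that] rep[of z] by (intro exI[of _ 0]) simp
  next
    case False
    then have "\<sigma> > 0"
      using le[OF y0(1)] by simp
    then show ?thesis
      using le[OF that] rep[of z] rep[of y0] y0(2)
      by (intro exI[of _ "(z \<bullet> b) / \<sigma>"]) (simp add: abs_divide)
  qed
  with y0(1) show thesis
    by (intro that) auto
qed

text \<open>In dimension one the endpoint of the segment \<open>\<langle>f\<rangle>\<^sub>Q\<close> is attained; in higher dimension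
  the constant 2 of the Auerbach-type lemma is absorbed by \<open>2 n \<le> n\<^sup>2\<close>.\<close>

lemma cavg_dual_frame:
  fixes f :: "'a::euclidean_space \<Rightarrow> 'b::euclidean_space"
  assumes f: "L1_loc f" and Q: "compact Q"
  obtains m l v M where "dual_frame (cavg f Q) m l v" "\<forall>k<m. \<forall>y\<in>cavg f Q. \<bar>l k y\<bar> \<le> M"
    "real m * M \<le> real DIM('b) ^ 2"
proof (cases "DIM('b) = 1")
  case True
  then obtain y0 where "y0 \<in> cavg f Q" "\<forall>z\<in>cavg f Q. \<exists>t. \<bar>t\<bar> \<le> 1 \<and> z = t *\<^sub>R y0"
    using cavg_segment[OF _ f Q] by blast
  then obtain m l v where "m \<le> 1" "dual_frame (cavg f Q) m l v" "\<forall>k<m. \<forall>y\<in>cavg f Q. \<bar>l k y\<bar> \<le> 1"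
    by (rule line_dual_frame)
  with True show thesis
    by (intro that[of m l v 1]) auto
next
  case False
  then have n: "2 \<le> DIM('b)"
    using DIM_positive[where 'a='b] by linarith
  obtain m l v where m: "m \<le> DIM('b)" and "dual_frame (cavg f Q) m l v" "\<forall>k<m. \<forall>y\<in>cavg f Q. \<bar>l k y\<bar> \<le> 2"
    using auerbach_dual_frame[OF bounded_cavg[OF f Q]] by blast
  moreover have "real m * 2 \<le> real DIM('b) ^ 2"
    using mult_mono[OF of_nat_mono[OF m] of_nat_mono[OF n]] by (simp add: power2_eq_square)
  ultimately show thesis
    using that[of m l v 2] by blast
qed

text \<open>A point of \<open>\<langle>f\<rangle>\<^sub>I\<close> outside \<open>A \<langle>f\<rangle>\<^sub>Q\<close> has frame coefficients of total size above \<open>A\<close>, since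
  otherwise it would be an absolute convex combination of the \<open>A v k\<close>.\<close>

lemma dual_frame_escape_average:
  fixes f :: "'a::euclidean_space \<Rightarrow> 'b::euclidean_space"
  assumes f: "L1_loc f"
    and IQ: "compact I" "compact Q" "I \<subseteq> Q" "measure lebesgue I > 0" "measure lebesgue Q > 0"
    and A: "A > 0" and frame: "dual_frame (cavg f Q) m l v"
    and escape: "\<not> cavg f I \<subseteq> (*\<^sub>R) A ` cavg f Q"
  shows "A * measure lebesgue I < (LINT x|lebesgue. indicator I x * (\<Sum>k<m. \<bar>l k (f x)\<bar>))"
proof -
  let ?K = "cavg f Q"
  have lin: "\<forall>k<m. linear (l k)"
    using frame by (simp add: dual_frame_def)
  obtain y where y: "y \<in> cavg f I" "y \<notin> (*\<^sub>R) A ` ?K"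
    using escape by blast
  have "y \<in> span ?K"
    using cavg_subset_scaleR[OF IQ(3,4,5)] y(1) by (auto intro: span_mul span_base)
  then have rep: "y = (\<Sum>k<m. l k y *\<^sub>R v k)"
    using frame by (simp add: dual_frame_def)
  have "A < (\<Sum>k<m. \<bar>l k y\<bar>)"
  proof (rule ccontr)
    assume "\<not> A < (\<Sum>k<m. \<bar>l k y\<bar>)"
    then have "(\<Sum>k<m. \<bar>l k y / A\<bar>) \<le> 1"
      using A by (simp add: sum_divide_distrib[symmetric])
    then have "(\<Sum>k<m. (l k y / A) *\<^sub>R v k) \<in> ?K"
      using frame unfolding dual_frame_def by (intro cavg_abs_combination[OF f IQ(2)]) auto
    moreover have "(1 / A) *\<^sub>R y = (\<Sum>k<m. (l k y / A) *\<^sub>R v k)"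
      by (subst (1) rep) (simp add: scaleR_sum_right)
    ultimately have "(1 / A) *\<^sub>R y \<in> ?K"
      by simp
    moreover have "y = A *\<^sub>R ((1 / A) *\<^sub>R y)"
      using A by simp
    ultimately show False
      using y(2) by blast
  qed
  also have "(\<Sum>k<m. \<bar>l k y\<bar>) \<le> (\<Sum>k<m. (LINT x|lebesgue. indicator I x * \<bar>l k (f x)\<bar>) / measure lebesgue I)"
    using lin by (intro sum_mono linear_cavg_le[OF _ f IQ(1) y(1)]) auto
  also have "\<dots> = (LINT x|lebesgue. indicator I x * (\<Sum>k<m. \<bar>l k (f x)\<bar>)) / measure lebesgue I"
    by (simp add: integral_indicator_sum_abs_linear(2)[OF lin f IQ(1)] sum_divide_distrib)
  finally show ?thesis
    using IQ(4) by (simp add: field_simps)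
qed

lemma dual_frame_integral_le:
  fixes f :: "'a::euclidean_space \<Rightarrow> 'b::euclidean_space"
  assumes f: "L1_loc f" and Q: "compact Q" "measure lebesgue Q > 0"
    and frame: "dual_frame (cavg f Q) m l v" and bound: "\<forall>k<m. \<forall>y\<in>cavg f Q. \<bar>l k y\<bar> \<le> M"
  shows "(LINT x|lebesgue. indicator Q x * (\<Sum>k<m. \<bar>l k (f x)\<bar>)) \<le> real m * M * measure lebesgue Q"
proof -
  have lin: "\<forall>k<m. linear (l k)"
    using frame by (simp add: dual_frame_def)
  have "(LINT x|lebesgue. indicator Q x * \<bar>l k (f x)\<bar>) \<le> M * measure lebesgue Q" if k: "k < m" for k
  proof -
    obtain y where y: "y \<in> cavg f Q"
      and "l k y = (LINT x|lebesgue. indicator Q x * \<bar>l k (f x)\<bar>) / measure lebesgue Q"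
      by (rule linear_cavg_attains[OF lin[rule_format, OF k] f Q(1)])
    moreover have "l k y \<le> M"
      using bound y k by (meson abs_le_D1)
    ultimately show ?thesis
      using Q(2) by (simp add: pos_divide_le_eq)
  qed
  then have "(\<Sum>k<m. LINT x|lebesgue. indicator Q x * \<bar>l k (f x)\<bar>) \<le> (\<Sum>k<m. M * measure lebesgue Q)"
    by (intro sum_mono) auto
  then show ?thesis
    by (simp add: integral_indicator_sum_abs_linear(2)[OF lin f Q(1)])
qed

section \<open>Heavy families of almost disjoint sets\<close>

lemma sum_integral_le_of_null_overlaps:
  fixes h :: "'a \<Rightarrow> real"
  assumes "finite F" "\<And>I. I \<in> F \<Longrightarrow> I \<subseteq> Q" "\<And>I. I \<in> F \<Longrightarrow> I \<in> sets M"
    and "pairwise (\<lambda>I J. I \<inter> J \<in> null_sets M) F"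
    and "\<And>x. h x \<ge> 0" "integrable M (\<lambda>x. indicator Q x * h x)"
  shows "(\<Sum>I\<in>F. LINT x|M. indicator I x * h x) \<le> (LINT x|M. indicator Q x * h x)"
proof -
  have int: "integrable M (\<lambda>x. indicator I x * h x)" if "I \<in> F" for I
  proof -
    have "(\<lambda>x. indicator I x * h x) = (\<lambda>x. indicator I x *\<^sub>R (indicator Q x * h x))"
      using assms(2)[OF that] by (auto simp: fun_eq_iff indicator_def)
    then show ?thesis
      using integrable_mult_indicator[OF assms(3)[OF that] assms(6)] by simp
  qed
  define N where "N = (\<Union>I\<in>F. \<Union>J\<in>F - {I}. I \<inter> J)"
  have N: "N \<in> null_sets M"
    unfolding N_def using assms(1,4) by (intro null_sets.finite_UN) (auto simp: pairwise_def)
  have "(\<Sum>I\<in>F. indicator I x * h x) \<le> indicator Q x * h x" if "x \<notin> N" for x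
  proof (cases "\<exists>I\<in>F. x \<in> I")
    case True
    then obtain I0 where I0: "I0 \<in> F" "x \<in> I0" by blast
    have "(\<Sum>I\<in>F. indicator I x * h x) = indicator I0 x * h x + (\<Sum>I\<in>F - {I0}. indicator I x * h x)"
      by (rule sum.remove[OF assms(1) I0(1)])
    also have "(\<Sum>I\<in>F - {I0}. indicator I x * h x) = 0"
      using that I0 unfolding N_def by (intro sum.neutral) auto
    moreover have "x \<in> Q"
      using I0 assms(2) by blast
    ultimately show ?thesis
      using I0 by simp
  next
    case False
    then show ?thesis using assms(5)[of x] by (simp add: sum.neutral)
  qed
  then have "AE x in M. (\<Sum>I\<in>F. indicator I x * h x) \<le> indicator Q x * h x"
    using N by (auto intro: AE_I')
  then have "(LINT x|M. (\<Sum>I\<in>F. indicator I x * h x)) \<le> (LINT x|M. indicator Q x * h x)"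
    using assms(6) int by (intro integral_mono_AE Bochner_Integration.integrable_sum) auto
  then show ?thesis
    using int by (simp add: Bochner_Integration.integral_sum)
qed

lemma infsum_emeasure_less_of_heavy:
  fixes h :: "'a \<Rightarrow> real" and \<I> :: "'a set set"
  assumes h: "\<And>x. h x \<ge> 0" "integrable M (\<lambda>x. indicator Q x * h x)"
    and sub: "\<And>I. I \<in> \<I> \<Longrightarrow> I \<subseteq> Q" "\<And>I. I \<in> \<I> \<Longrightarrow> I \<in> fmeasurable M"
    and null: "pairwise (\<lambda>I J. I \<inter> J \<in> null_sets M) \<I>"
    and heavy: "\<And>I. I \<in> \<I> \<Longrightarrow> A * measure M I < (LINT x|M. indicator I x * h x)"
    and A: "A > 0" and "\<I> \<noteq> {}"
  shows "(\<Sum>\<^sub>\<infinity>I\<in>\<I>. emeasure M I) < ennreal ((LINT x|M. indicator Q x * h x) / A)"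
proof -
  let ?H = "\<lambda>I. LINT x|M. indicator I x * h x"
  have sum_le: "(\<Sum>I\<in>F. ?H I) \<le> ?H Q" if "finite F" "F \<subseteq> \<I>" for F
    using that(2) sub
    by (intro sum_integral_le_of_null_overlaps[OF that(1) _ _ pairwise_subset[OF null that(2)] h]) auto
  txt \<open>The slack of a single member \<open>I0\<close> bounds all finite partial sums away from \<open>?H Q / A\<close>.\<close>
  obtain I0 where I0: "I0 \<in> \<I>"
    using \<open>\<I> \<noteq> {}\<close> by blast
  define \<delta> where "\<delta> = ?H I0 / A - measure M I0"
  have gap: "0 < ?H I / A - measure M I" if "I \<in> \<I>" for I
    using heavy[OF that] A by (simp add: field_simps)
  have finite_sums: "(\<Sum>I\<in>F. measure M I) \<le> ?H Q / A - \<delta>" if F: "finite F" "F \<subseteq> \<I>" for F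
  proof -
    let ?G = "insert I0 F"
    have G: "finite ?G" "?G \<subseteq> \<I>" using F I0 by auto
    have "\<delta> \<le> (\<Sum>I\<in>?G. ?H I / A - measure M I)"
      unfolding \<delta>_def using G gap by (intro member_le_sum) (auto intro: less_imp_le)
    moreover have "(\<Sum>I\<in>F. measure M I) \<le> (\<Sum>I\<in>?G. measure M I)"
      using G by (intro sum_mono2) auto
    moreover have "(\<Sum>I\<in>?G. ?H I / A) \<le> ?H Q / A"
      using sum_le[OF G] A by (simp add: sum_divide_distrib[symmetric] divide_right_mono)
    ultimately show ?thesis
      by (simp add: sum_subtractf)
  qed
  have "(\<Sum>\<^sub>\<infinity>I\<in>\<I>. emeasure M I) \<le> ennreal (?H Q / A - \<delta>)"
  proof (rule infsum_le_finite_sums)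
    show "(\<lambda>I. emeasure M I) summable_on \<I>"
      by (rule nonneg_summable_on_complete) simp
    fix F assume F: "finite F" "F \<subseteq> \<I>"
    then have "(\<Sum>I\<in>F. emeasure M I) = (\<Sum>I\<in>F. ennreal (measure M I))"
      using sub(2) by (intro sum.cong) (auto simp: emeasure_eq_measure2)
    then show "(\<Sum>I\<in>F. emeasure M I) \<le> ennreal (?H Q / A - \<delta>)"
      using finite_sums[OF F] by (simp add: ennreal_leI)
  qed
  also have "\<dots> < ennreal (?H Q / A)"
    using finite_sums[of "{}"] gap[OF I0] by (intro ennreal_lessI) (auto simp: \<delta>_def)
  finally show ?thesis .
qed

section \<open>Maximal dyadic subcubes\<close>

lemma cavg_maximal_dyadic_subset:
  fixes f :: "'a::euclidean_space \<Rightarrow> 'b::euclidean_space"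
  assumes f: "L1_loc f" and A: "A \<ge> 1" and I: "dyadic_subcube I Q"
    and escape: "\<not> cavg f I \<subseteq> (*\<^sub>R) A ` cavg f Q"
    and maximal: "\<And>J. dyadic_subcube J Q \<Longrightarrow> \<not> cavg f J \<subseteq> (*\<^sub>R) A ` cavg f Q \<Longrightarrow> I \<subseteq> J \<Longrightarrow> J = I"
  shows "cavg f I \<subseteq> (*\<^sub>R) (2 ^ DIM('a) * A) ` cavg f Q"
proof
  fix y assume y: "y \<in> cavg f I"
  have "is_cube Q"
    using I unfolding is_cube_def by (blast elim: dyadic_subcubeE)
  then have "compact Q"
    using dyadic_subcubeD(2)[OF dyadic_subcube_refl] by blast
  then have "I \<noteq> Q"
    using escape cavg_subset_dilation[OF f _ A] by blast
  then obtain J where J: "dyadic_subcube J Q" "I \<subset> J"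
    and mJ: "measure lebesgue J = 2 ^ DIM('a) * measure lebesgue I"
    by (rule dyadic_subcube_parent[OF I])
  have "cavg f J \<subseteq> (*\<^sub>R) A ` cavg f Q"
    using maximal[OF J(1)] J(2) by blast
  moreover obtain z where "z \<in> cavg f J" "y = (measure lebesgue J / measure lebesgue I) *\<^sub>R z"
    using cavg_subset_scaleR[of I J] J(2) dyadic_subcubeD(3)[OF I] dyadic_subcubeD(3)[OF J(1)] y by blast
  ultimately obtain w where "w \<in> cavg f Q" "y = (2 ^ DIM('a) * A) *\<^sub>R w"
    using mJ dyadic_subcubeD(3)[OF I] by auto
  then show "y \<in> (*\<^sub>R) (2 ^ DIM('a) * A) ` cavg f Q"
    by blast
qed

lemma dyadic_antichain_pairwise_null:
  assumes "\<And>I. I \<in> \<I> \<Longrightarrow> dyadic_subcube I Q" "\<And>I J. I \<in> \<I> \<Longrightarrow> J \<in> \<I> \<Longrightarrow> I \<subseteq> J \<Longrightarrow> J = I"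
  shows "pairwise (\<lambda>I J. I \<inter> J \<in> null_sets lebesgue) \<I>"
  unfolding pairwise_def using assms dyadic_subcube_nested_or_null by metis

section \<open>The stopping-time estimate\<close>

lemma infsum_escaping_less_integral:
  fixes f :: "'a::euclidean_space \<Rightarrow> 'b::euclidean_space"
  assumes f: "L1_loc f" and Q: "is_cube Q" and A: "A > 0"
    and frame: "dual_frame (cavg f Q) m l v"
    and \<I>: "\<And>I. I \<in> \<I> \<Longrightarrow> dyadic_subcube I Q" "\<And>I. I \<in> \<I> \<Longrightarrow> \<not> cavg f I \<subseteq> (*\<^sub>R) A ` cavg f Q"
    and antichain: "\<And>I J. I \<in> \<I> \<Longrightarrow> J \<in> \<I> \<Longrightarrow> I \<subseteq> J \<Longrightarrow> J = I"
    and "\<I> \<noteq> {}"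
  shows "(\<Sum>\<^sub>\<infinity>I\<in>\<I>. emeasure lebesgue I) <
    ennreal ((LINT x|lebesgue. indicator Q x * (\<Sum>k<m. \<bar>l k (f x)\<bar>)) / A)"
proof (rule infsum_emeasure_less_of_heavy[OF _ _ _ _ _ _ A \<open>\<I> \<noteq> {}\<close>])
  note Q' = dyadic_subcubeD[OF dyadic_subcube_refl[OF Q]]
  show "0 \<le> (\<Sum>k<m. \<bar>l k (f x)\<bar>)" for x
    by (simp add: sum_nonneg)
  show "integrable lebesgue (\<lambda>x. indicator Q x * (\<Sum>k<m. \<bar>l k (f x)\<bar>))"
    using frame unfolding dual_frame_def by (intro integral_indicator_sum_abs_linear(1)[OF _ f Q'(2)]) simp
  show "I \<subseteq> Q" "I \<in> lmeasurable" if "I \<in> \<I>" for I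
    using dyadic_subcubeD[OF \<I>(1)[OF that]] by auto
  show "pairwise (\<lambda>I J. I \<inter> J \<in> null_sets lebesgue) \<I>"
    using \<I>(1) antichain by (rule dyadic_antichain_pairwise_null)
  show "A * measure lebesgue I < (LINT x|lebesgue. indicator I x * (\<Sum>k<m. \<bar>l k (f x)\<bar>))"
    if "I \<in> \<I>" for I
    using dyadic_subcubeD[OF \<I>(1)[OF that]] Q'
    by (intro dual_frame_escape_average[OF f _ Q'(2) _ _ Q'(3) A frame \<I>(2)[OF that]])
qed

lemma infsum_escaping_dyadic_antichain_less:
  fixes f :: "'a::euclidean_space \<Rightarrow> 'b::euclidean_space"
  assumes f: "L1_loc f" and Q: "is_cube Q" and A: "A > 0"
    and \<I>: "\<And>I. I \<in> \<I> \<Longrightarrow> dyadic_subcube I Q" "\<And>I. I \<in> \<I> \<Longrightarrow> \<not> cavg f I \<subseteq> (*\<^sub>R) A ` cavg f Q"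
    and antichain: "\<And>I J. I \<in> \<I> \<Longrightarrow> J \<in> \<I> \<Longrightarrow> I \<subseteq> J \<Longrightarrow> J = I"
  shows "(\<Sum>\<^sub>\<infinity>I\<in>\<I>. emeasure lebesgue I) < ennreal (real DIM('b) ^ 2 / A) * emeasure lebesgue Q"
proof -
  let ?n = "real DIM('b)"
  note Q' = dyadic_subcubeD[OF dyadic_subcube_refl[OF Q]]
  obtain m l v M where frame: "dual_frame (cavg f Q) m l v"
    and bound: "\<forall>k<m. \<forall>y\<in>cavg f Q. \<bar>l k y\<bar> \<le> M" and mM: "real m * M \<le> ?n ^ 2"
    by (rule cavg_dual_frame[OF f Q'(2)])
  have "(LINT x|lebesgue. indicator Q x * (\<Sum>k<m. \<bar>l k (f x)\<bar>)) \<le> real m * M * measure lebesgue Q"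
    by (rule dual_frame_integral_le[OF f Q'(2,3) frame bound])
  also have "\<dots> \<le> ?n ^ 2 * measure lebesgue Q"
    using mM Q'(3) by (intro mult_right_mono) auto
  finally have hQ: "(LINT x|lebesgue. indicator Q x * (\<Sum>k<m. \<bar>l k (f x)\<bar>)) / A \<le> ?n ^ 2 / A * measure lebesgue Q"
    using A by (simp add: divide_right_mono)
  have rhs: "ennreal (?n ^ 2 / A * measure lebesgue Q) = ennreal (?n ^ 2 / A) * emeasure lebesgue Q"
    using A Q'(4) by (subst ennreal_mult) (auto simp: emeasure_eq_measure2)
  show ?thesis
  proof (cases "\<I> = {}")
    case True
    then show ?thesis
      using A Q'(3) by (simp flip: rhs)
  next
    case False
    have "(\<Sum>\<^sub>\<infinity>I\<in>\<I>. emeasure lebesgue I) <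
        ennreal ((LINT x|lebesgue. indicator Q x * (\<Sum>k<m. \<bar>l k (f x)\<bar>)) / A)"
      by (rule infsum_escaping_less_integral[OF f Q A frame \<I>(1,2) antichain False])
    also have "\<dots> \<le> ennreal (?n ^ 2 / A * measure lebesgue Q)"
      using hQ by (rule ennreal_leI)
    finally show ?thesis
      unfolding rhs .
  qed
qed

theorem lemma3p6:
  fixes f :: "'a::euclidean_space \<Rightarrow> 'b::euclidean_space"
    and A :: real and Q :: "'a set"
  assumes "A > real (DIM('b)) ^ 2" and "L1_loc f" and "is_cube Q"
  defines "\<I> \<equiv> {I. dyadic_subcube I Q \<and> \<not> cavg f I \<subseteq> (*\<^sub>R) A ` cavg f Q \<and>
              (\<forall>J. dyadic_subcube J Q \<and> \<not> cavg f J \<subseteq> (*\<^sub>R) A ` cavg f Q \<and> I \<subseteq> J \<longrightarrow> J = I)}"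
  shows "(\<forall>I\<in>\<I>. cavg f I \<subseteq> (*\<^sub>R) (2 ^ DIM('a) * A) ` cavg f Q) \<and>
         (\<Sum>\<^sub>\<infinity>I\<in>\<I>. emeasure lebesgue I) < ennreal (real (DIM('b)) ^ 2 / A) * emeasure lebesgue Q"
proof
  have "real DIM('b) ^ 2 \<ge> 1"
    using DIM_positive[where 'a='b] by simp
  then have A: "A > 0" "A \<ge> 1"
    using assms(1) by linarith+
  have I: "dyadic_subcube I Q" "\<not> cavg f I \<subseteq> (*\<^sub>R) A ` cavg f Q"
    "\<And>J. dyadic_subcube J Q \<Longrightarrow> \<not> cavg f J \<subseteq> (*\<^sub>R) A ` cavg f Q \<Longrightarrow> I \<subseteq> J \<Longrightarrow> J = I"
    if "I \<in> \<I>" for I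
    using that unfolding \<I>_def by simp_all
  show "\<forall>I\<in>\<I>. cavg f I \<subseteq> (*\<^sub>R) (2 ^ DIM('a) * A) ` cavg f Q"
    using cavg_maximal_dyadic_subset[OF assms(2) A(2) I] by blast
  show "(\<Sum>\<^sub>\<infinity>I\<in>\<I>. emeasure lebesgue I) < ennreal (real DIM('b) ^ 2 / A) * emeasure lebesgue Q"
    using I by (intro infsum_escaping_dyadic_antichain_less[OF assms(2,3) A(1)]) blast+
qed

end
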